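(* An integral domain $D$ is a UVFD if and only if $D$ is a weakly Matlis GCD-domain.
   Context: Let $D$ be an integral domain with quotient field $K$. An overring of $D$ is a subring of $K$ containing $D$. A nonzero nonunit $a\in D$ is a valuation element of $D$ if there is a valuation domain $V$ that is an overring of $D$ with $aV\cap D=aD$. Two elements $x,y\in D$ are incomparable if the ideals $xD$ and $yD$ are incomparable under inclusion. A finite sequence (or product) of incomparable elements means that entries with distinct indices are pairwise incomparable. $D$ is a UVFD (unique valuation factorization domain) if (i) every nonzero nonunit of $D$ is a finite product of incomparable valuation elements of $D$, and (ii) whenever $n,m\in\mathbb{N}$ (positive integers) and $(a_i)_{i=1}^n$, $(b_j)_{j=1}^m$ are two sequences of incomparable valuation elements of $D$ with $\prod_{i=1}^n a_i=\prod_{j=1}^m b_j$, then $n=m$ and there is a permutation $\sigma$ of $\{1,\dots,n\}$ with $a_iD=b_{\sigma(i)}D$ for each $i$. For a nonzero fractional ideal $A$ let $A^{-1}=\{x\in K\mid xA\subseteq D\}$, $A_v=(A^{-1})^{-1}$ and $A_t=\bigcup\{I_v\mid I\subseteq A,\ I$ a nonzero finitely generated fractional ideal$\}$. $A$ is a $t$-ideal if $A_t=A$. A maximal $t$-ideal is a $t$-ideal maximal among proper integral $t$-ideals. $D$ is a weakly Matlis domain if each nonzero nonunit of $D$ lies in only finitely many maximal $t$-ideals and no two distinct maximal $t$-ideals of $D$ contain a common nonzero prime ideal. A weakly Matlis GCD-domain is a GCD-domain that is a weakly Matlis domain. *)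

theory Defs
  imports
    Complex_Main
    "HOL-Computational_Algebra.Polynomial_Factorial"
    "HOL-Combinatorics.Permutations"
begin

text \<open>
  The integral domain \<open>D\<close> is a type \<open>'a :: idom\<close>, its quotient field \<open>K\<close> is \<open>'a fract\<close>, and
  \<open>D\<close> sits in \<open>K\<close> as \<open>range to_fract\<close>.  Overrings and fractional ideals are subsets of
  \<open>'a fract\<close>; integral ideals are subsets of \<open>'a\<close>, viewed as fractional ideals via their image
  under \<open>to_fract\<close>.  Properties of \<open>D\<close> as a whole are predicates on \<open>'a itself\<close>.
\<close>

definition overring :: "'a::idom fract set \<Rightarrow> bool" where
  "overring V \<longleftrightarrow> range to_fract \<subseteq> V \<and>
     (\<forall>x\<in>V. \<forall>y\<in>V. x - y \<in> V) \<and> (\<forall>x\<in>V. \<forall>y\<in>V. x * y \<in> V)"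

text \<open>The quotient field of an overring of \<open>D\<close> is again \<open>K\<close>, so the usual definition of a
  valuation domain (\<open>x\<close> or \<open>x\<inverse>\<close> belongs to it, for \<open>x \<noteq> 0\<close> in its quotient field) reads as follows.\<close>

definition valuation_overring :: "'a::idom fract set \<Rightarrow> bool" where
  "valuation_overring V \<longleftrightarrow> overring V \<and> (\<forall>x. x \<noteq> 0 \<longrightarrow> x \<in> V \<or> inverse x \<in> V)"

definition valuation_element :: "'a::idom \<Rightarrow> bool" where
  "valuation_element a \<longleftrightarrow> a \<noteq> 0 \<and> \<not> a dvd 1 \<and>
     (\<exists>V. valuation_overring V \<and>
          (*) (to_fract a) ` V \<inter> range to_fract = (*) (to_fract a) ` range to_fract)"

definition principal_ideal :: "'a::idom \<Rightarrow> 'a set" where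
  "principal_ideal a = range ((*) a)"

definition incomparable :: "'a::idom \<Rightarrow> 'a \<Rightarrow> bool" where
  "incomparable x y \<longleftrightarrow>
     \<not> principal_ideal x \<subseteq> principal_ideal y \<and> \<not> principal_ideal y \<subseteq> principal_ideal x"

text \<open>Sequences indexed by \<open>{1..n}\<close> with \<open>n\<close> positive are nonempty lists, indexed from \<open>0\<close>.\<close>

definition incomparable_valuation_seq :: "'a::idom list \<Rightarrow> bool" where
  "incomparable_valuation_seq xs \<longleftrightarrow> xs \<noteq> [] \<and> (\<forall>x\<in>set xs. valuation_element x) \<and>
     (\<forall>i<length xs. \<forall>j<length xs. i \<noteq> j \<longrightarrow> incomparable (xs ! i) (xs ! j))"

definition UVFD :: "'a::idom itself \<Rightarrow> bool" where
  "UVFD _ \<longleftrightarrow>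
     (\<forall>a::'a. a \<noteq> 0 \<and> \<not> a dvd 1 \<longrightarrow>
        (\<exists>xs. incomparable_valuation_seq xs \<and> a = prod_list xs)) \<and>
     (\<forall>xs ys :: 'a list.
        incomparable_valuation_seq xs \<and> incomparable_valuation_seq ys \<and>
        prod_list xs = prod_list ys \<longrightarrow>
        length xs = length ys \<and>
        (\<exists>\<sigma>. \<sigma> permutes {..<length xs} \<and>
             (\<forall>i<length xs. principal_ideal (xs ! i) = principal_ideal (ys ! \<sigma> i))))"

definition fract_scale :: "'a::idom \<Rightarrow> 'a fract \<Rightarrow> 'a fract" where
  "fract_scale d x = to_fract d * x"

lemma module_fract_scale: "module fract_scale"
  by unfold_locales (auto simp: fract_scale_def algebra_simps)

lemma module_times: "module ((*) :: 'a::idom \<Rightarrow> 'a \<Rightarrow> 'a)"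
  by unfold_locales (auto simp: algebra_simps)

definition nonzero_fractional_ideal :: "'a::idom fract set \<Rightarrow> bool" where
  "nonzero_fractional_ideal A \<longleftrightarrow> module.subspace fract_scale A \<and> A \<noteq> {0} \<and>
     (\<exists>d. d \<noteq> 0 \<and> fract_scale d ` A \<subseteq> range to_fract)"

definition fg_nonzero_fractional_ideal :: "'a::idom fract set \<Rightarrow> bool" where
  "fg_nonzero_fractional_ideal A \<longleftrightarrow> nonzero_fractional_ideal A \<and>
     (\<exists>S. finite S \<and> A = module.span fract_scale S)"

definition inverse_ideal :: "'a::idom fract set \<Rightarrow> 'a fract set" where
  "inverse_ideal A = {x. (*) x ` A \<subseteq> range to_fract}"

definition v_closure :: "'a::idom fract set \<Rightarrow> 'a fract set" where
  "v_closure A = inverse_ideal (inverse_ideal A)"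

definition t_closure :: "'a::idom fract set \<Rightarrow> 'a fract set" where
  "t_closure A = \<Union> {v_closure I | I. I \<subseteq> A \<and> fg_nonzero_fractional_ideal I}"

definition t_ideal :: "'a::idom fract set \<Rightarrow> bool" where
  "t_ideal A \<longleftrightarrow> nonzero_fractional_ideal A \<and> t_closure A = A"

definition proper_integral_t_ideal :: "'a::idom set \<Rightarrow> bool" where
  "proper_integral_t_ideal I \<longleftrightarrow> t_ideal (to_fract ` I) \<and> I \<noteq> UNIV"

definition maximal_t_ideal :: "'a::idom set \<Rightarrow> bool" where
  "maximal_t_ideal M \<longleftrightarrow> proper_integral_t_ideal M \<and>
     (\<forall>J. proper_integral_t_ideal J \<and> M \<subseteq> J \<longrightarrow> J = M)"

definition prime_ideal :: "'a::idom set \<Rightarrow> bool" where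
  "prime_ideal P \<longleftrightarrow> module.subspace (*) P \<and> P \<noteq> UNIV \<and>
     (\<forall>x y. x * y \<in> P \<longrightarrow> x \<in> P \<or> y \<in> P)"

definition weakly_Matlis_domain :: "'a::idom itself \<Rightarrow> bool" where
  "weakly_Matlis_domain _ \<longleftrightarrow>
     (\<forall>a::'a. a \<noteq> 0 \<and> \<not> a dvd 1 \<longrightarrow> finite {M. maximal_t_ideal M \<and> a \<in> M}) \<and>
     (\<forall>M N :: 'a set. maximal_t_ideal M \<and> maximal_t_ideal N \<and> M \<noteq> N \<longrightarrow>
        \<not> (\<exists>P. prime_ideal P \<and> P \<noteq> {0} \<and> P \<subseteq> M \<and> P \<subseteq> N))"

text \<open>Only the existence of greatest common divisors is required; the library class
  \<open>semiring_gcd\<close> would instead fix a normalized choice of them.\<close>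

definition GCD_domain :: "'a::idom itself \<Rightarrow> bool" where
  "GCD_domain _ \<longleftrightarrow> (\<forall>a b :: 'a. a \<noteq> 0 \<and> b \<noteq> 0 \<longrightarrow>
     (\<exists>d. d dvd a \<and> d dvd b \<and> (\<forall>c. c dvd a \<and> c dvd b \<longrightarrow> c dvd d)))"

definition weakly_Matlis_GCD_domain :: "'a::idom itself \<Rightarrow> bool" where
  "weakly_Matlis_GCD_domain D \<longleftrightarrow> GCD_domain D \<and> weakly_Matlis_domain D"

end

theory Submission
  imports Defs
begin

text \<open>
  The nonunit divisors of a valuation element are valuation elements, any two of them are comparable,
  and the product of two comparable valuation elements is a valuation element. Comparable factors
  can therefore be merged, so that every product of valuation elements is a product of incomparable
  ones (\<open>incomparable_valuations_insert\<close>).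

  In a UVFD, uniqueness forces incomparable valuation elements to be coprime, because a common
  nonunit divisor could be moved from one to the other (\<open>UVFD_incomparable_coprime\<close>). Up to units the
  nonzero elements then form a direct sum of totally ordered monoids, one for each class of
  comparable valuation elements, and greatest common divisors can be computed one class at a time
  (\<open>UVFD_imp_GCD_domain\<close>). Conversely, incomparable valuation elements of a GCD-domain are always
  coprime, which makes factorizations into them unique (\<open>GCD_domain_factorization_unique\<close>).

  In a GCD-domain, \<open>t\<close>-ideals are the nonzero ideals in which any two elements have a common divisor
  that again lies in the ideal. A maximal one is prime, and its localization is a valuation domain.
  If it contains a valuation element \<open>a\<close>, it consists of the elements that are not coprime to \<open>a\<close>
  (\<open>maximal_t_ideal_of_valuation_element\<close>); in this way valuation factorizations give the weakly
  Matlis property. In the other direction, an element that lies in just one maximal \<open>t\<close>-ideal is a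
  valuation element. If \<open>x\<close> lies in two of them, \<open>M\<close> and \<open>N\<close>, then \<open>x = u * v\<close> with \<open>u \<notin> M\<close> and
  \<open>v \<notin> N\<close>, for otherwise \<open>M\<close> and \<open>N\<close> would share a nonzero prime (\<open>weakly_Matlis_dvd_mult\<close>).
  Splitting in this manner ends after finitely many steps, since \<open>x\<close> lies in finitely many maximal
  \<open>t\<close>-ideals.
\<close>

section \<open>Valuation elements\<close>

lemma principal_ideal_subset_iff: "principal_ideal x \<subseteq> principal_ideal y \<longleftrightarrow> y dvd x"
proof
  assume "principal_ideal x \<subseteq> principal_ideal y"
  moreover have "x \<in> principal_ideal x"
    unfolding principal_ideal_def by (metis mult.right_neutral rangeI)
  ultimately show "y dvd x" by (auto simp: principal_ideal_def)
next
  assume "y dvd x"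
  then show "principal_ideal x \<subseteq> principal_ideal y"
    by (auto simp: principal_ideal_def dvd_def image_def mult.assoc)
qed

lemma principal_ideal_eq_iff: "principal_ideal x = principal_ideal y \<longleftrightarrow> x dvd y \<and> y dvd x"
  using principal_ideal_subset_iff by blast

lemma incomparable_iff: "incomparable x y \<longleftrightarrow> \<not> x dvd y \<and> \<not> y dvd x"
  by (auto simp: incomparable_def principal_ideal_subset_iff)

lemma incomparable_sym: "incomparable x y \<longleftrightarrow> incomparable y x"
  by (auto simp: incomparable_iff)

lemma valuation_element_iff:
  "valuation_element a \<longleftrightarrow> a \<noteq> 0 \<and> \<not> a dvd 1 \<and>
     (\<exists>V. valuation_overring V \<and> (\<forall>x. to_fract x / to_fract a \<in> V \<longrightarrow> a dvd x))"
proof -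
  have eq: "(*) (to_fract a) ` V \<inter> range to_fract = (*) (to_fract a) ` range to_fract \<longleftrightarrow>
      (\<forall>x. to_fract x / to_fract a \<in> V \<longrightarrow> a dvd x)" (is "?L = ?R")
    if a: "a \<noteq> 0" and V: "valuation_overring V" for V
  proof
    assume L: ?L
    show ?R
    proof (intro allI impI)
      fix x assume "to_fract x / to_fract a \<in> V"
      moreover have "to_fract x = to_fract a * (to_fract x / to_fract a)" using a by simp
      ultimately have "to_fract x \<in> (*) (to_fract a) ` V \<inter> range to_fract" by blast
      then obtain d where "to_fract x = to_fract a * to_fract d" unfolding L by auto
      then have "x = a * d" by (metis to_fract_eq_iff to_fract_mult)
      then show "a dvd x" by simp
    qed
  next
    assume R: ?R
    show ?L
    proof (intro equalityI subsetI)
      fix t assume "t \<in> (*) (to_fract a) ` V \<inter> range to_fract"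
      then obtain v x where v: "v \<in> V" "t = to_fract a * v" and x: "t = to_fract x" by auto
      then have "v = to_fract x / to_fract a" using a by (simp add: field_simps)
      then have "a dvd x" using R v by blast
      then show "t \<in> (*) (to_fract a) ` range to_fract" using x unfolding dvd_def by auto
    next
      fix t assume "t \<in> (*) (to_fract a) ` range to_fract"
      then obtain d where t: "t = to_fract a * to_fract d" by auto
      have "to_fract d \<in> V" using V by (auto simp: valuation_overring_def overring_def)
      moreover have "t = to_fract (a * d)" using t by simp
      ultimately show "t \<in> (*) (to_fract a) ` V \<inter> range to_fract" using t by blast
    qed
  qed
  show ?thesis by (simp add: valuation_element_def eq cong: conj_cong)
qed

lemma valuation_element_nonzero: "valuation_element a \<Longrightarrow> a \<noteq> 0"
  and valuation_element_nonunit: "valuation_element a \<Longrightarrow> \<not> a dvd 1"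
  by (auto simp: valuation_element_def)

lemma overring_mult: "valuation_overring V \<Longrightarrow> x \<in> V \<Longrightarrow> y \<in> V \<Longrightarrow> x * y \<in> V"
  and overring_to_fract: "valuation_overring V \<Longrightarrow> to_fract d \<in> V"
  by (auto simp: valuation_overring_def overring_def)

text \<open>The valuation overring that witnesses \<open>a\<close> also witnesses every factor \<open>b\<close> of \<open>a = b * c\<close>:
  if \<open>x / b\<close> lies in it, then so does \<open>x * c / a\<close>.\<close>

lemma valuation_overring_factor:
  assumes V: "\<forall>x. to_fract x / to_fract a \<in> V \<longrightarrow> a dvd x" and a: "a \<noteq> 0" and "b dvd a"
    and x: "to_fract x / to_fract b \<in> V"
  shows "b dvd x"
proof -
  obtain c where c: "a = b * c" using \<open>b dvd a\<close> by blast
  then have "to_fract (x * c) / to_fract a = to_fract x / to_fract b" using a by simp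
  then have "a dvd x * c" using V x by metis
  then show ?thesis using c a by simp
qed

lemma valuation_element_factor:
  assumes "valuation_element a" "b dvd a" "\<not> b dvd 1"
  shows "valuation_element b"
  using assms valuation_overring_factor unfolding valuation_element_iff
  by (metis dvd_0_left)

text \<open>Of two factors of a valuation element, one divides the other in the witnessing valuation
  overring, and this descends to the domain.\<close>

lemma valuation_element_factors_chain:
  assumes "valuation_element a" "b dvd a" "c dvd a"
  shows "\<not> incomparable b c"
proof -
  obtain V where a: "a \<noteq> 0" and V: "valuation_overring V"
    "\<forall>x. to_fract x / to_fract a \<in> V \<longrightarrow> a dvd x"
    using assms(1) unfolding valuation_element_iff by blast
  have "to_fract b / to_fract c \<noteq> 0" using a assms by auto
  then have "to_fract b / to_fract c \<in> V \<or> to_fract c / to_fract b \<in> V"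
    using V(1) unfolding valuation_overring_def by (metis inverse_divide)
  then show ?thesis
    using valuation_overring_factor[OF V(2) a] assms(2,3) unfolding incomparable_iff by blast
qed

text \<open>One overring witnesses both \<open>a\<close> and its factor \<open>b\<close>, so \<open>a\<close> and \<open>b\<close> can be divided out one after
  the other.\<close>

lemma valuation_element_mult_dvd:
  assumes "valuation_element a" "b dvd a"
  shows "valuation_element (a * b)"
proof -
  obtain V where a: "a \<noteq> 0" "\<not> a dvd 1" and V: "valuation_overring V"
    "\<forall>x. to_fract x / to_fract a \<in> V \<longrightarrow> a dvd x"
    using assms(1) unfolding valuation_element_iff by blast
  have b: "b \<noteq> 0" using assms(2) a by auto
  have "a * b dvd x" if x: "to_fract x / to_fract (a * b) \<in> V" for x
  proof -
    have "to_fract x / to_fract a = to_fract x / to_fract (a * b) * to_fract b"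
      using b by simp
    then have "a dvd x" using V x overring_mult overring_to_fract by metis
    then obtain y where y: "x = a * y" by blast
    then have "to_fract y / to_fract b \<in> V" using x a by simp
    then show ?thesis
      using valuation_overring_factor[OF V(2) a(1) assms(2)] y by (simp add: mult_dvd_mono)
  qed
  then show ?thesis
    using a b V(1) unfolding valuation_element_iff
    by (metis dvd_mult_left mult_eq_0_iff)
qed

lemma valuation_element_mult:
  assumes "valuation_element a" "valuation_element b" "\<not> incomparable a b"
  shows "valuation_element (a * b)"
  using assms valuation_element_mult_dvd unfolding incomparable_iff by (metis mult.commute)

section \<open>Products of incomparable valuation elements\<close>

text \<open>Unlike \<^const>\<open>incomparable_valuation_seq\<close>, this admits the empty list, which makes
  induction possible.\<close>

definition incomparable_valuations :: "'a::idom list \<Rightarrow> bool" where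
  "incomparable_valuations xs \<longleftrightarrow> (\<forall>x\<in>set xs. valuation_element x) \<and> sorted_wrt incomparable xs"

lemma incomparable_valuation_seq_iff:
  "incomparable_valuation_seq xs \<longleftrightarrow> xs \<noteq> [] \<and> incomparable_valuations xs"
proof -
  have "(\<forall>i<length xs. \<forall>j<length xs. i \<noteq> j \<longrightarrow> incomparable (xs ! i) (xs ! j)) \<longleftrightarrow>
      sorted_wrt incomparable xs"
    (is "?L \<longleftrightarrow> ?R")
  proof
    show "?L \<Longrightarrow> ?R" by (simp add: sorted_wrt_iff_nth_less)
    assume R: ?R
    show ?L
    proof (intro allI impI)
      fix i j assume "i < length xs" "j < length xs" "i \<noteq> j"
      then show "incomparable (xs ! i) (xs ! j)"
        using R incomparable_sym[of "xs ! i" "xs ! j"]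
        by (cases "i < j") (auto simp: sorted_wrt_iff_nth_less)
    qed
  qed
  then show ?thesis
    by (auto simp: incomparable_valuation_seq_def incomparable_valuations_def)
qed

lemma incomparable_valuations_Nil: "incomparable_valuations []"
  by (simp add: incomparable_valuations_def)

lemma incomparable_valuations_Cons:
  "incomparable_valuations (x # xs) \<longleftrightarrow>
     valuation_element x \<and> (\<forall>y\<in>set xs. incomparable x y) \<and> incomparable_valuations xs"
  by (auto simp: incomparable_valuations_def)

lemma dvd_prod_list: "x \<in> set xs \<Longrightarrow> x dvd prod_list (xs :: 'a::idom list)"
  by (induction xs) auto

lemma incomparable_valuations_prod_nonzero: "incomparable_valuations xs \<Longrightarrow> prod_list xs \<noteq> 0"
  by (auto simp: incomparable_valuations_def prod_list_zero_iff dest: valuation_element_nonzero)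

text \<open>A new valuation factor \<open>a\<close> is absorbed by the entry of the list with which it is comparable,
  if there is one, and is appended otherwise. Incomparability survives because the factors of a
  valuation element form a chain: whatever is comparable with a multiple of \<open>a\<close> that is a valuation
  element is comparable with \<open>a\<close> itself.\<close>

lemma incomparable_valuations_insert:
  assumes "valuation_element a" "incomparable_valuations zs"
  shows "\<exists>ws. incomparable_valuations ws \<and> prod_list ws = a * prod_list zs \<and>
    (\<forall>w\<in>set ws. w \<in> set zs \<or> a dvd w) \<and> (\<exists>w\<in>set ws. a dvd w)"
  using assms(2)
proof (induction zs)
  case Nil
  then show ?case
    using assms(1) by (intro exI[of _ "[a]"]) (auto simp: incomparable_valuations_def)
next
  case (Cons z zs)
  then have z: "valuation_element z" "\<forall>y\<in>set zs. incomparable z y" "incomparable_valuations zs"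
    by (auto simp: incomparable_valuations_Cons)
  show ?case
  proof (cases "incomparable a z")
    case False
    then have az: "valuation_element (a * z)" using assms z valuation_element_mult by blast
    have "incomparable (a * z) y" if "y \<in> set zs" for y
    proof -
      have zy: "incomparable z y" using that z by blast
      then have "\<not> y dvd a * z"
        using valuation_element_factors_chain[OF az, of z y] by auto
      moreover have "\<not> a * z dvd y" using zy by (auto simp: incomparable_iff dest: dvd_mult_right)
      ultimately show ?thesis by (simp add: incomparable_iff)
    qed
    then show ?thesis
      using az z by (intro exI[of _ "a * z # zs"]) (auto simp: incomparable_valuations_Cons mult.assoc)
  next
    case True
    obtain ws where ws: "incomparable_valuations ws" "prod_list ws = a * prod_list zs"
      "\<forall>w\<in>set ws. w \<in> set zs \<or> a dvd w" "\<exists>w\<in>set ws. a dvd w"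
      using Cons.IH z by blast
    have "incomparable z w" if w: "w \<in> set ws" for w
    proof (cases "w \<in> set zs")
      case True
      then show ?thesis using z by blast
    next
      case False
      then have aw: "a dvd w" using ws w by blast
      have "valuation_element w" using ws w by (auto simp: incomparable_valuations_def)
      then have "\<not> z dvd w" using valuation_element_factors_chain aw True by blast
      moreover have "\<not> w dvd z" using aw True by (meson dvd_trans incomparable_iff)
      ultimately show ?thesis by (simp add: incomparable_iff)
    qed
    then show ?thesis
      using ws z by (intro exI[of _ "z # ws"]) (auto simp: incomparable_valuations_Cons mult_ac)
  qed
qed

lemma valuation_product_imp_incomparable:
  assumes "\<forall>x\<in>set xs. valuation_element x"
  shows "\<exists>ws. incomparable_valuations ws \<and> prod_list ws = prod_list xs"
  using assms
proof (induction xs)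
  case Nil
  then show ?case using incomparable_valuations_Nil by blast
next
  case (Cons x xs)
  then show ?case using incomparable_valuations_insert[of x] by (metis list.set_intros prod_list.Cons)
qed

section \<open>Coprime elements and greatest common divisors\<close>

definition relatively_prime :: "'a::idom \<Rightarrow> 'a \<Rightarrow> bool" where
  "relatively_prime a b \<longleftrightarrow> (\<forall>c. c dvd a \<and> c dvd b \<longrightarrow> c dvd 1)"

definition is_gcd :: "'a::idom \<Rightarrow> 'a \<Rightarrow> 'a \<Rightarrow> bool" where
  "is_gcd d a b \<longleftrightarrow> d dvd a \<and> d dvd b \<and> (\<forall>c. c dvd a \<and> c dvd b \<longrightarrow> c dvd d)"

lemma GCD_domain_iff: "GCD_domain TYPE('a::idom) \<longleftrightarrow> (\<forall>a b :: 'a. a \<noteq> 0 \<and> b \<noteq> 0 \<longrightarrow> (\<exists>d. is_gcd d a b))"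
  by (simp add: GCD_domain_def is_gcd_def)

lemma GCD_domain_gcd_exists:
  assumes "GCD_domain TYPE('a::idom)"
  obtains d where "is_gcd d (a::'a) b"
proof (cases "a = 0 \<or> b = 0")
  case True
  then have "is_gcd b a b \<or> is_gcd a a b" by (auto simp: is_gcd_def)
  then show ?thesis using that by blast
next
  case False
  then show ?thesis using assms that by (auto simp: GCD_domain_iff)
qed

lemma is_gcd_mult_left:
  assumes G: "GCD_domain TYPE('a::idom)" and d: "is_gcd d (a::'a) b"
  shows "is_gcd (r * d) (r * a) (r * b)"
proof (cases "r = 0")
  case False
  obtain e where e: "is_gcd e (r * a) (r * b)" using GCD_domain_gcd_exists[OF G] .
  then have "r * d dvd e" "r dvd e" using d by (auto simp: is_gcd_def mult_dvd_mono)
  then obtain f where f: "e = r * f" by blast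
  then have "f dvd a" "f dvd b" using e False by (auto simp: is_gcd_def)
  then have "e dvd r * d" using d f by (auto simp: is_gcd_def mult_dvd_mono)
  then show ?thesis
    using e d unfolding is_gcd_def by (meson dvd_trans dvd_refl mult_dvd_mono)
qed (auto simp: is_gcd_def)

lemma relatively_prime_dvd_mult:
  assumes G: "GCD_domain TYPE('a::idom)" and "relatively_prime (a::'a) b" "a dvd b * c"
  shows "a dvd c"
proof -
  have "is_gcd 1 a b" using assms(2) by (auto simp: is_gcd_def relatively_prime_def)
  then have "is_gcd (c * 1) (c * a) (c * b)" by (rule is_gcd_mult_left[OF G])
  then show ?thesis using assms(3) by (auto simp: is_gcd_def mult.commute)
qed

lemma gcd_cofactors:
  assumes G: "GCD_domain TYPE('a::idom)"
  obtains d a' b' where "(a::'a) = d * a'" "b = d * b'" "relatively_prime a' b'"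
proof -
  obtain d where d: "is_gcd d a b" using GCD_domain_gcd_exists[OF G] .
  then obtain a' b' where ab: "a = d * a'" "b = d * b'" unfolding is_gcd_def by blast
  show ?thesis
  proof (cases "d = 0")
    case True
    have "a = d * 1" "b = d * 1" "relatively_prime (1::'a) 1"
      using ab True by (auto simp: relatively_prime_def)
    then show ?thesis using that by blast
  next
    case False
    have "c dvd 1" if "c dvd a'" "c dvd b'" for c
    proof -
      have "d * c dvd d" using d that ab by (auto simp: is_gcd_def)
      then have "d * c dvd d * 1" by simp
      then show ?thesis using False by (simp only: dvd_mult_cancel_left simp_thms)
    qed
    then have "relatively_prime a' b'" by (simp add: relatively_prime_def)
    then show ?thesis using that ab by blast
  qed
qed

text \<open>Take for \<open>u\<close> the greatest common divisor of \<open>x\<close> and \<open>s\<close>; its cofactor in \<open>x\<close> is coprime to the one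
  in \<open>s\<close> and so divides \<open>t\<close>.\<close>

lemma GCD_domain_split:
  assumes G: "GCD_domain TYPE('a::idom)" and "(x::'a) dvd s * t" "x \<noteq> 0"
  obtains u v where "x = u * v" "u dvd s" "v dvd t"
proof -
  obtain u v s' where x: "x = u * v" and s: "s = u * s'" and rp: "relatively_prime v s'"
    using gcd_cofactors[OF G] .
  have "v dvd s' * t" using assms(2,3) x s by (auto simp: mult.assoc)
  then have "v dvd t" using relatively_prime_dvd_mult[OF G rp] by blast
  then show ?thesis using that x s by simp
qed

section \<open>Uniqueness of factorizations in GCD-domains\<close>

text \<open>Let \<open>a = d * a'\<close> and \<open>b = d * b'\<close> with \<open>a'\<close> and \<open>b'\<close> coprime. Then \<open>a'\<close> and
  \<open>b'\<close> are incomparable, and \<open>d\<close> is comparable with each of them by the chain property in \<open>a\<close> and in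
  \<open>b\<close>. If \<open>d\<close> were a multiple of \<open>a'\<close> or \<open>b'\<close>, both would divide \<open>b\<close> or both would divide \<open>a\<close>. So \<open>d\<close>
  divides \<open>a'\<close> and \<open>b'\<close> and is a unit.\<close>

lemma GCD_domain_incomparable_coprime:
  assumes G: "GCD_domain TYPE('a::idom)" and a: "valuation_element (a::'a)"
    and b: "valuation_element b" and ab: "incomparable a b"
  shows "relatively_prime a b"
proof -
  obtain d a' b' where d: "a = d * a'" "b = d * b'" and rp: "relatively_prime a' b'"
    using gcd_cofactors[OF G] .
  have ab': "incomparable a' b'" using ab d by (auto simp: incomparable_iff)
  have da: "\<not> incomparable d a'" and db: "\<not> incomparable d b'"
    using valuation_element_factors_chain[OF a] valuation_element_factors_chain[OF b]
    unfolding d by (meson dvd_triv_left dvd_triv_right)+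
  have "\<not> a' dvd d"
  proof
    assume "a' dvd d"
    then have "a' dvd b" "b' dvd b" using d by auto
    then show False using valuation_element_factors_chain[OF b] ab' by blast
  qed
  moreover have "\<not> b' dvd d"
  proof
    assume "b' dvd d"
    then have "a' dvd a" "b' dvd a" using d by auto
    then show False using valuation_element_factors_chain[OF a] ab' by blast
  qed
  ultimately have "d dvd 1" using da db rp by (auto simp: incomparable_iff relatively_prime_def)
  have "a dvd a' * 1" "b dvd b' * 1"
    using \<open>d dvd 1\<close> d by (metis dvd_refl mult.commute mult_dvd_mono)+
  then show ?thesis using rp unfolding relatively_prime_def by (metis dvd_trans mult.right_neutral)
qed

text \<open>A valuation element that divides \<open>y * p\<close> with \<open>y\<close> and \<open>p\<close> coprime splits into a factor of \<open>y\<close> and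
  a factor of \<open>p\<close>; these two are comparable and coprime, so one of them is a unit.\<close>

lemma GCD_domain_valuation_dvd_prod:
  assumes G: "GCD_domain TYPE('a::idom)"
    and "valuation_element (a::'a)" "incomparable_valuations ys" "a dvd prod_list ys"
  shows "\<exists>y\<in>set ys. a dvd y"
  using assms(2-)
proof (induction ys arbitrary: a)
  case Nil
  then show ?case by (simp add: valuation_element_nonunit)
next
  case (Cons y ys)
  then have y: "valuation_element y" "\<forall>z\<in>set ys. incomparable y z" "incomparable_valuations ys"
    by (auto simp: incomparable_valuations_Cons)
  have a0: "a \<noteq> 0" using Cons.prems valuation_element_nonzero by blast
  obtain u v where uv: "a = u * v" "u dvd y" "v dvd prod_list ys"
    using GCD_domain_split[OF G _ a0, of y "prod_list ys"] Cons.prems(3) by auto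
  have unit: "e dvd 1" if e: "e dvd a" "e dvd y" "e dvd prod_list ys" for e
  proof (rule ccontr)
    assume n: "\<not> e dvd 1"
    then have "valuation_element e" using e Cons.prems(1) valuation_element_factor by blast
    then obtain z where "z \<in> set ys" "e dvd z" using Cons.IH y e by blast
    moreover from this have "relatively_prime y z"
      using GCD_domain_incomparable_coprime[OF G] y by (auto simp: incomparable_valuations_def)
    ultimately show False using n e by (auto simp: relatively_prime_def)
  qed
  have "\<not> incomparable u v" using valuation_element_factors_chain[OF Cons.prems(1)] uv(1) by simp
  then have "u dvd 1 \<or> v dvd 1"
    using unit[of u] unit[of v] uv unfolding incomparable_iff by (meson dvd_trans dvd_triv_left dvd_triv_right)
  then show ?case
  proof
    assume "u dvd 1"
    then have "a dvd 1 * v" using uv by (simp add: mult_dvd_mono)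
    then have "a dvd v" by simp
    then have "a dvd prod_list ys" using uv(3) by (rule dvd_trans)
    then show ?thesis using Cons.IH Cons.prems(1) y by auto
  next
    assume "v dvd 1"
    then have "a dvd u * 1" using uv by (simp add: mult_dvd_mono)
    then have "a dvd u" by simp
    then have "a dvd y" using uv(2) by (rule dvd_trans)
    then show ?thesis by simp
  qed
qed

lemma incomparable_valuation_seq_dvd_unique:
  assumes "incomparable_valuation_seq xs" "i < length xs" "j < length xs" "xs ! i dvd xs ! j"
  shows "i = j"
  using assms unfolding incomparable_valuation_seq_def incomparable_iff by blast

text \<open>Divisibility assigns to each entry of one sequence an entry of the other. The two assignments
  are mutually inverse because an entry divides no other entry of its own sequence.\<close>

lemma GCD_domain_factorization_unique:
  assumes G: "GCD_domain TYPE('a::idom)"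
    and xs: "incomparable_valuation_seq (xs::'a list)" and ys: "incomparable_valuation_seq ys"
    and eq: "prod_list xs = prod_list ys"
  shows "length xs = length ys \<and> (\<exists>\<sigma>. \<sigma> permutes {..<length xs} \<and>
    (\<forall>i<length xs. principal_ideal (xs ! i) = principal_ideal (ys ! \<sigma> i)))"
proof -
  have key: "\<exists>j<length vs. us ! i dvd vs ! j"
    if "incomparable_valuation_seq us" "incomparable_valuation_seq vs"
      "prod_list us = prod_list vs" "i < length us" for us vs :: "'a list" and i
  proof -
    have "\<exists>v\<in>set vs. us ! i dvd v"
      using that dvd_prod_list[of "us ! i" us]
      by (intro GCD_domain_valuation_dvd_prod[OF G])
        (auto simp: incomparable_valuation_seq_iff incomparable_valuations_def)
    then show ?thesis by (metis in_set_conv_nth)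
  qed
  obtain f where f: "\<And>i. i < length xs \<Longrightarrow> f i < length ys \<and> xs ! i dvd ys ! f i"
    using key[OF xs ys eq] by metis
  obtain g where g: "\<And>j. j < length ys \<Longrightarrow> g j < length xs \<and> ys ! j dvd xs ! g j"
    using key[OF ys xs eq[symmetric]] by metis
  have gf: "g (f i) = i" if "i < length xs" for i
    using incomparable_valuation_seq_dvd_unique[OF xs, of i "g (f i)"] f g that by (metis dvd_trans)
  have fg: "f (g j) = j" if "j < length ys" for j
    using incomparable_valuation_seq_dvd_unique[OF ys, of j "f (g j)"] f g that by (metis dvd_trans)
  have bij: "bij_betw f {..<length xs} {..<length ys}"
    by (rule bij_betw_byWitness[where f' = g]) (use f g fg gf in auto)
  then have len: "length xs = length ys" using bij_betw_same_card by fastforce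
  define \<sigma> where "\<sigma> i = (if i < length xs then f i else i)" for i
  have "bij_betw \<sigma> {..<length xs} {..<length xs}"
    using bij len by (metis (no_types, lifting) \<sigma>_def bij_betw_cong lessThan_iff)
  then have "\<sigma> permutes {..<length xs}"
    by (rule bij_imp_permutes) (simp add: \<sigma>_def)
  moreover have "principal_ideal (xs ! i) = principal_ideal (ys ! \<sigma> i)" if "i < length xs" for i
    using f[OF that] g[of "f i"] gf[OF that] that by (simp add: \<sigma>_def principal_ideal_eq_iff)
  ultimately show ?thesis using len by blast
qed

section \<open>A UVFD is a GCD-domain\<close>

lemma UVFD_factorization:
  assumes "UVFD TYPE('a::idom)" "(a::'a) \<noteq> 0" "\<not> a dvd 1"
  obtains xs where "incomparable_valuations xs" "prod_list xs = a"
  using assms unfolding UVFD_def incomparable_valuation_seq_iff by metis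

lemma UVFD_same_factors:
  assumes "UVFD TYPE('a::idom)" "incomparable_valuations (xs::'a list)" "incomparable_valuations ys"
    and "prod_list xs = prod_list ys" "x \<in> set xs" "ys \<noteq> []"
  shows "\<exists>y\<in>set ys. x dvd y \<and> y dvd x"
proof -
  have "incomparable_valuation_seq xs" "incomparable_valuation_seq ys"
    using assms by (auto simp: incomparable_valuation_seq_iff)
  then obtain \<sigma> where \<sigma>: "length xs = length ys" "\<sigma> permutes {..<length xs}"
    "\<forall>i<length xs. principal_ideal (xs ! i) = principal_ideal (ys ! \<sigma> i)"
    using assms(1,4) unfolding UVFD_def by blast
  obtain i where "i < length xs" "xs ! i = x" using assms(5) by (metis in_set_conv_nth)
  moreover from this have "\<sigma> i < length ys" using \<sigma> permutes_in_image by fastforce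
  ultimately show ?thesis using \<sigma>(3) by (metis nth_mem principal_ideal_eq_iff)
qed

text \<open>A nonunit common divisor \<open>d\<close> of \<open>a\<close> and \<open>x = d * x'\<close> could be moved from \<open>x\<close> to \<open>a\<close>: then
  \<open>a * x\<close> and \<open>(a * d) * x'\<close> would be two different factorizations of the same element. Here
  \<open>x'\<close> does not divide \<open>a * d\<close> because \<open>x\<close> and \<open>a\<close> would otherwise both divide the valuation element
  \<open>a * d * d\<close>.\<close>

lemma UVFD_incomparable_coprime:
  assumes U: "UVFD TYPE('a::idom)" and a: "valuation_element (a::'a)"
    and x: "valuation_element x" and ax: "incomparable a x"
  shows "relatively_prime a x"
proof (rule ccontr)
  assume "\<not> relatively_prime a x"
  then obtain d where d: "d dvd a" "d dvd x" "\<not> d dvd 1" by (auto simp: relatively_prime_def)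
  then obtain x' where x': "x = d * x'" by blast
  have "\<not> x' dvd 1"
  proof
    assume "x' dvd 1"
    then have "x dvd d * 1" unfolding x' by (intro mult_dvd_mono) auto
    then have "x dvd a" using d dvd_trans by auto
    then show False using ax by (simp add: incomparable_iff)
  qed
  then have vx': "valuation_element x'" using valuation_element_factor[OF x] x' by auto
  have ad: "valuation_element (a * d)" using a d valuation_element_mult_dvd by blast
  have add: "valuation_element (a * d * d)" using valuation_element_mult_dvd[OF ad] by simp
  have "\<not> x' dvd a * d"
  proof
    assume "x' dvd a * d"
    then have "x dvd a * d * d" unfolding x' by (simp add: mult.commute mult_dvd_mono)
    moreover have "a dvd a * d * d" by (simp add: mult.assoc)
    ultimately show False using valuation_element_factors_chain[OF add] ax by blast
  qed
  moreover have "\<not> a * d dvd x'"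
    using ax x' by (auto simp: incomparable_iff dest: dvd_mult_left)
  ultimately have "incomparable (a * d) x'" by (simp add: incomparable_iff)
  then have "incomparable_valuations [a * d, x']" "incomparable_valuations [a, x]"
    using a x ad vx' ax by (auto simp: incomparable_valuations_def)
  moreover have "prod_list [a * d, x'] = prod_list [a, x]" using x' by (simp add: mult_ac)
  ultimately have "\<exists>y\<in>set [a, x]. a * d dvd y \<and> y dvd a * d"
    by (intro UVFD_same_factors[OF U]) auto
  then consider "a * d dvd a" | "a * d dvd x" by auto
  then show False
  proof cases
    case 1
    then have "a * d dvd a * 1" by simp
    then show ?thesis using d valuation_element_nonzero[OF a] by (metis dvd_mult_cancel_left)
  next
    case 2
    then show ?thesis using ax by (auto simp: incomparable_iff dest: dvd_mult_left)
  qed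
qed

text \<open>Let \<open>f\<close> be the cofactor of \<open>e\<close> in the product. Merging \<open>e\<close> into a factorization of \<open>f\<close> gives a
  second factorization of the product in which some entry is a multiple of \<open>e\<close>; uniqueness carries
  this entry over to \<open>zs\<close>.\<close>

lemma UVFD_valuation_dvd_prod:
  assumes U: "UVFD TYPE('a::idom)" and e: "valuation_element (e::'a)"
    and zs: "incomparable_valuations zs" and dvd: "e dvd prod_list zs"
  shows "\<exists>z\<in>set zs. e dvd z"
proof -
  obtain f where f: "prod_list zs = e * f" using dvd by blast
  have "prod_list zs \<noteq> 0" using zs incomparable_valuations_prod_nonzero by blast
  then have f0: "f \<noteq> 0" using f by auto
  have zs0: "zs \<noteq> []" using dvd valuation_element_nonunit[OF e] by auto
  obtain ws where ws: "incomparable_valuations ws" "prod_list ws = e * f" "\<exists>w\<in>set ws. e dvd w"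
  proof (cases "f dvd 1")
    case True
    then have "e * f dvd e * 1" by (intro mult_dvd_mono) auto
    then have "valuation_element (e * f)"
      using e valuation_element_factor valuation_element_nonunit by (metis dvd_mult_left mult.right_neutral)
    then have "incomparable_valuations [e * f]" by (simp add: incomparable_valuations_def)
    then show ?thesis using that[of "[e * f]"] by simp
  next
    case False
    then obtain fs where "incomparable_valuations fs" "prod_list fs = f"
      using UVFD_factorization[OF U f0] by blast
    then show ?thesis using incomparable_valuations_insert[OF e, of fs] that by blast
  qed
  then obtain w where w: "w \<in> set ws" "e dvd w" by blast
  obtain z where "z \<in> set zs" "w dvd z"
    using UVFD_same_factors[OF U ws(1) zs _ w(1) zs0] ws f by auto
  then show ?thesis using w dvd_trans by blast
qed

text \<open>After \<open>c\<close> is merged into a factorization of \<open>z\<close>, the entry that \<open>a\<close> divides cannot be the one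
  that absorbed \<open>c\<close>, since \<open>a\<close> and \<open>c\<close> would then be comparable. So it was there before.\<close>

lemma UVFD_dvd_cancel_incomparable:
  assumes U: "UVFD TYPE('a::idom)" and a: "valuation_element (a::'a)" and c: "valuation_element c"
    and ac: "incomparable a c" and z: "z \<noteq> 0" and dvd: "a dvd c * z"
  shows "a dvd z"
proof (cases "z dvd 1")
  case True
  then have "c * z dvd c * 1" by (intro mult_dvd_mono) auto
  then have "a dvd c" using dvd_trans[OF dvd, of c] by simp
  then have False using ac by (simp add: incomparable_iff)
  then show ?thesis ..
next
  case False
  then obtain zs where zs: "incomparable_valuations zs" "prod_list zs = z"
    using UVFD_factorization[OF U z] by blast
  obtain ws where ws: "incomparable_valuations ws" "prod_list ws = c * z"
    "\<forall>w\<in>set ws. w \<in> set zs \<or> c dvd w"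
    using incomparable_valuations_insert[OF c zs(1)] zs by auto
  obtain w where w: "w \<in> set ws" "a dvd w"
    using UVFD_valuation_dvd_prod[OF U a ws(1)] ws dvd by auto
  have "valuation_element w" using ws w by (auto simp: incomparable_valuations_def)
  then have "\<not> c dvd w" using valuation_element_factors_chain w ac by blast
  then show ?thesis using ws w zs dvd_prod_list dvd_trans by blast
qed

text \<open>Factors of incomparable valuation elements are coprime, so they divide \<open>z\<close> simultaneously as
  soon as each of them does.\<close>

lemma UVFD_prod_dvd:
  assumes U: "UVFD TYPE('a::idom)" and "incomparable_valuations (xs::'a list)"
    and "\<And>x. x \<in> set xs \<Longrightarrow> g x dvd x \<and> g x dvd z" and "z \<noteq> 0"
  shows "prod_list (map g xs) dvd z"
  using assms(2-)
proof (induction xs arbitrary: z)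
  case Nil
  then show ?case by simp
next
  case (Cons x xs)
  then have x: "valuation_element x" "\<forall>y\<in>set xs. incomparable x y" "incomparable_valuations xs"
    by (auto simp: incomparable_valuations_Cons)
  obtain z' where z': "z = g x * z'" using Cons.prems(2)[of x] by auto
  have z0: "z' \<noteq> 0" using z' Cons.prems(3) by auto
  have "g y dvd z'" if y: "y \<in> set xs" for y
  proof (cases "g x dvd 1 \<or> g y dvd 1")
    case True
    moreover have "z dvd z'" if "g x dvd 1"
      using mult_dvd_mono[OF that dvd_refl[of z']] z' by simp
    ultimately show ?thesis using Cons.prems(2) y by (meson dvd_trans one_dvd list.set_intros(2))
  next
    case False
    have vy: "valuation_element y" using x y by (auto simp: incomparable_valuations_def)
    have gx: "g x dvd x" and gy: "g y dvd y" "g y dvd z" using Cons.prems(2) y by auto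
    have vg: "valuation_element (g x)" "valuation_element (g y)"
      using False valuation_element_factor x vy gx gy by blast+
    have "relatively_prime x y" using UVFD_incomparable_coprime[OF U x(1) vy] x y by blast
    then have "incomparable (g y) (g x)"
      using False gx gy unfolding relatively_prime_def incomparable_iff by (meson dvd_trans)
    then show ?thesis
      using UVFD_dvd_cancel_incomparable[OF U vg(2,1)] z0 gy z' by auto
  qed
  then have "prod_list (map g xs) dvd z'" using Cons.IH[OF x(3)] Cons.prems(2) z0 by auto
  then show ?case using z' by (simp add: mult_dvd_mono)
qed

text \<open>If a valuation element \<open>a\<close> and \<open>y\<close> have a nonunit common divisor \<open>e\<^sub>0\<close>, then \<open>e\<^sub>0\<close> singles out
  one factor \<open>z\<close> of \<open>y\<close>, and every common divisor of \<open>a\<close> and \<open>y\<close>, being comparable with \<open>e\<^sub>0\<close>,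
  divides this same \<open>z\<close>. As \<open>a\<close> and \<open>z\<close> are comparable, the smaller of the two is the greatest
  common divisor.\<close>

lemma UVFD_gcd_valuation_element:
  assumes U: "UVFD TYPE('a::idom)" and a: "valuation_element (a::'a)" and y: "y \<noteq> 0"
  shows "\<exists>g. is_gcd g a y"
proof (cases "relatively_prime a y")
  case True
  then have "is_gcd 1 a y" by (auto simp: is_gcd_def relatively_prime_def)
  then show ?thesis ..
next
  case False
  then obtain e0 where e0: "e0 dvd a" "e0 dvd y" "\<not> e0 dvd 1"
    by (auto simp: relatively_prime_def)
  then have "\<not> y dvd 1" using dvd_trans by blast
  then obtain ys where ys: "incomparable_valuations ys" "prod_list ys = y"
    using UVFD_factorization[OF U y] by blast
  have val: "valuation_element e" if "e dvd a" "\<not> e dvd 1" for e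
    using valuation_element_factor[OF a] that by blast
  have factor: "\<exists>z\<in>set ys. e dvd z" if "e dvd a" "e dvd y" "\<not> e dvd 1" for e
    using UVFD_valuation_dvd_prod[OF U val ys(1)] ys(2) that by blast
  obtain z where z: "z \<in> set ys" "e0 dvd z" using factor e0 by blast
  have vz: "valuation_element w" if "w \<in> set ys" for w
    using that ys by (auto simp: incomparable_valuations_def)
  have common: "e dvd z" if e: "e dvd a" "e dvd y" for e
  proof (cases "e dvd 1 \<or> e dvd e0")
    case True
    then show ?thesis using z by (meson dvd_trans one_dvd)
  next
    case False
    then have "e0 dvd e"
      using valuation_element_factors_chain[OF a] e e0 by (auto simp: incomparable_iff)
    obtain w where w: "w \<in> set ys" "e dvd w" using factor e False by blast
    have "z = w"
    proof (rule ccontr)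
      assume "z \<noteq> w"
      then have "incomparable z w"
        using ys(1) z w unfolding incomparable_valuations_def sorted_wrt_iff_nth_less
        by (metis in_set_conv_nth incomparable_sym linorder_neqE_nat)
      then have "relatively_prime z w" using UVFD_incomparable_coprime[OF U] vz z w by blast
      then show False using e0 z w \<open>e0 dvd e\<close> by (meson dvd_trans relatively_prime_def)
    qed
    then show ?thesis using w by simp
  qed
  have zy: "z dvd y" using dvd_prod_list z ys by blast
  have "\<not> relatively_prime a z" using e0 z by (auto simp: relatively_prime_def)
  then consider "a dvd z" | "z dvd a"
    using UVFD_incomparable_coprime[OF U a vz[OF z(1)]] by (auto simp: incomparable_iff)
  then show ?thesis
  proof cases
    case 1
    then have "is_gcd a a y" using zy by (auto simp: is_gcd_def dest: dvd_trans)
    then show ?thesis ..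
  next
    case 2
    then have "is_gcd z a y" using zy common by (auto simp: is_gcd_def)
    then show ?thesis ..
  qed
qed

text \<open>The greatest common divisor of \<open>x\<close> and \<open>y\<close> is the product of those of \<open>y\<close> with the factors of
  \<open>x\<close>: every valuation element that divides \<open>x\<close> divides one factor of \<open>x\<close>.\<close>

lemma UVFD_imp_GCD_domain:
  assumes U: "UVFD TYPE('a::idom)"
  shows "GCD_domain TYPE('a)"
  unfolding GCD_domain_iff
proof (intro allI impI)
  fix x y :: 'a assume xy: "x \<noteq> 0 \<and> y \<noteq> 0"
  show "\<exists>d. is_gcd d x y"
  proof (cases "x dvd 1")
    case True
    then have "is_gcd x x y" by (meson dvd_trans dvd_refl is_gcd_def one_dvd)
    then show ?thesis ..
  next
    case False
    then obtain xs where xs: "incomparable_valuations xs" "prod_list xs = x"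
      using UVFD_factorization[OF U] xy by blast
    then have vx: "valuation_element z" if "z \<in> set xs" for z
      using that by (auto simp: incomparable_valuations_def)
    then have "\<forall>z\<in>set xs. \<exists>g. is_gcd g z y"
      using UVFD_gcd_valuation_element[OF U] xy by blast
    then obtain g where g: "\<And>z. z \<in> set xs \<Longrightarrow> is_gcd (g z) z y" by metis
    let ?G = "prod_list (map g xs)"
    have "?G dvd y" using UVFD_prod_dvd[OF U xs(1), of g y] g xy by (auto simp: is_gcd_def)
    moreover have "?G dvd x"
    proof (rule UVFD_prod_dvd[OF U xs(1)])
      fix z assume z: "z \<in> set xs"
      then have "g z dvd z" "z dvd x" using g xs dvd_prod_list by (auto simp: is_gcd_def)
      then show "g z dvd z \<and> g z dvd x" using dvd_trans by blast
    qed (use xy in auto)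
    moreover have "c dvd ?G" if c: "c dvd x" "c dvd y" for c
    proof (cases "c dvd 1")
      case True
      then show ?thesis by (meson dvd_trans one_dvd)
    next
      case False
      moreover have "c \<noteq> 0" using c xy by auto
      ultimately obtain cs where cs: "incomparable_valuations cs" "prod_list cs = c"
        using UVFD_factorization[OF U] by blast
      have G0: "?G \<noteq> 0" using \<open>?G dvd x\<close> xy by auto
      have "e dvd ?G" if e: "e \<in> set cs" for e
      proof -
        have ec: "e dvd c" using dvd_prod_list e cs by blast
        have "valuation_element e" using cs e by (auto simp: incomparable_valuations_def)
        then obtain z where z: "z \<in> set xs" "e dvd z"
          using UVFD_valuation_dvd_prod[OF U _ xs(1)] xs c ec dvd_trans by blast
        then have "e dvd g z" using g c ec dvd_trans unfolding is_gcd_def by blast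
        moreover have "g z dvd ?G" using z dvd_prod_list[of "g z" "map g xs"] by auto
        ultimately show ?thesis using dvd_trans by blast
      qed
      then have "prod_list (map (\<lambda>e. e) cs) dvd ?G"
        by (intro UVFD_prod_dvd[OF U cs(1)]) (use G0 in auto)
      then show ?thesis using cs by simp
    qed
    ultimately have "is_gcd ?G x y" by (simp add: is_gcd_def)
    then show ?thesis ..
  qed
qed

section \<open>The \<open>t\<close>-ideals of a GCD-domain\<close>

text \<open>Such a set is an ideal: a sum is divisible by any common divisor of its summands. It is the
  directed union of the principal ideals that it contains.\<close>

definition directed_ideal :: "'a::idom set \<Rightarrow> bool" where
  "directed_ideal I \<longleftrightarrow> 0 \<in> I \<and> (\<exists>x\<in>I. x \<noteq> 0) \<and> (\<forall>a\<in>I. \<forall>x. a dvd x \<longrightarrow> x \<in> I) \<and>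
     (\<forall>a\<in>I. \<forall>b\<in>I. \<exists>d\<in>I. d dvd a \<and> d dvd b)"

lemma directed_ideal_zero: "directed_ideal I \<Longrightarrow> 0 \<in> I"
  and directed_ideal_nonzero: "directed_ideal I \<Longrightarrow> \<exists>x\<in>I. x \<noteq> 0"
  by (simp_all add: directed_ideal_def)

lemma directed_ideal_dvd: "directed_ideal I \<Longrightarrow> a \<in> I \<Longrightarrow> a dvd x \<Longrightarrow> x \<in> I"
  and directed_ideal_common_divisor:
    "directed_ideal I \<Longrightarrow> a \<in> I \<Longrightarrow> b \<in> I \<Longrightarrow> \<exists>d\<in>I. d dvd a \<and> d dvd b"
  by (auto simp: directed_ideal_def)

lemma directed_ideal_gcd:
  assumes "directed_ideal I" "a \<in> I" "b \<in> I" "is_gcd d a b"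
  shows "d \<in> I"
  using directed_ideal_common_divisor[OF assms(1-3)] assms(4) directed_ideal_dvd[OF assms(1)]
  unfolding is_gcd_def by blast

lemma directed_ideal_eq_UNIV_iff: "directed_ideal I \<Longrightarrow> I = UNIV \<longleftrightarrow> 1 \<in> I"
  using directed_ideal_dvd by (metis UNIV_I UNIV_eq_I one_dvd)

lemma fract_subspace_iff:
  "module.subspace fract_scale A \<longleftrightarrow>
     0 \<in> A \<and> (\<forall>x\<in>A. \<forall>y\<in>A. x + y \<in> A) \<and> (\<forall>c. \<forall>x\<in>A. to_fract c * x \<in> A)"
  by (simp add: module.subspace_def[OF module_fract_scale] fract_scale_def)

lemma directed_ideal_imp_fract_subspace:
  assumes "directed_ideal I"
  shows "module.subspace fract_scale (to_fract ` I)"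
proof -
  have "a + b \<in> I" if "a \<in> I" "b \<in> I" for a b
    using directed_ideal_common_divisor[OF assms that] directed_ideal_dvd[OF assms] dvd_add by blast
  moreover have "c * a \<in> I" if "a \<in> I" for a c
    using directed_ideal_dvd[OF assms that] by simp
  moreover have "0 \<in> I" using assms by (simp add: directed_ideal_def)
  ultimately show ?thesis
    unfolding fract_subspace_iff by (auto simp flip: to_fract_add to_fract_mult simp: image_iff)
qed

lemma fract_subspace_multiples:
  "module.subspace fract_scale (range (\<lambda>c. to_fract (d * c)))"
  unfolding fract_subspace_iff
proof (intro conjI ballI allI)
  have "0 = to_fract (d * 0)" by simp
  then show "0 \<in> range (\<lambda>c. to_fract (d * c))" by blast
next
  fix x y assume "x \<in> range (\<lambda>c. to_fract (d * c))" "y \<in> range (\<lambda>c. to_fract (d * c))"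
  then obtain a b where "x = to_fract (d * a)" "y = to_fract (d * b)" by blast
  then have "x + y = to_fract (d * (a + b))" by (simp add: algebra_simps)
  then show "x + y \<in> range (\<lambda>c. to_fract (d * c))" by blast
next
  fix c x assume "x \<in> range (\<lambda>c. to_fract (d * c))"
  then obtain a where "x = to_fract (d * a)" by blast
  then have "to_fract c * x = to_fract (d * (c * a))" by (simp add: algebra_simps)
  then show "to_fract c * x \<in> range (\<lambda>c. to_fract (d * c))" by blast
qed

lemma fg_nonzero_fractional_ideal_span:
  fixes a b :: "'a::idom"
  assumes "b \<noteq> 0"
  shows "fg_nonzero_fractional_ideal (module.span fract_scale {to_fract a, to_fract b})"
proof -
  let ?J = "module.span fract_scale {to_fract a, to_fract b}"
  have "?J \<subseteq> range (\<lambda>c. to_fract (1 * c))"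
    by (rule module.span_minimal[OF module_fract_scale _ fract_subspace_multiples]) auto
  then have scale: "fract_scale 1 ` ?J \<subseteq> range to_fract" by (auto simp: fract_scale_def)
  have "to_fract b \<in> ?J" by (rule module.span_base[OF module_fract_scale]) simp
  moreover have "to_fract b \<notin> {0}" using assms by simp
  ultimately have nonzero: "?J \<noteq> {0}" by metis
  have "nonzero_fractional_ideal ?J"
    unfolding nonzero_fractional_ideal_def
  proof (intro conjI exI)
    show "module.subspace fract_scale ?J" by (rule module.subspace_span[OF module_fract_scale])
    show "(1::'a) \<noteq> 0" by simp
  qed (rule nonzero scale)+
  then show ?thesis
    unfolding fg_nonzero_fractional_ideal_def by (intro conjI exI[of _ "{to_fract a, to_fract b}"]) simp_all
qed

lemma mem_v_closure_iff:
  "x \<in> v_closure A \<longleftrightarrow> (\<forall>y. (\<forall>z\<in>A. y * z \<in> range to_fract) \<longrightarrow> x * y \<in> range to_fract)"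
  by (auto simp: v_closure_def inverse_ideal_def image_subset_iff)

text \<open>Finitely many elements of a directed ideal are multiples of a single one of its elements \<open>d\<close>,
  so the \<open>v\<close>-closure of what they generate stays inside the multiples of \<open>d\<close>.\<close>

lemma directed_ideal_imp_t_ideal:
  assumes I: "directed_ideal I"
  shows "t_ideal (to_fract ` I)"
proof -
  obtain b where b: "b \<in> I" "b \<noteq> 0" using I by (auto simp: directed_ideal_def)
  note sub = directed_ideal_imp_fract_subspace[OF I]
  have "nonzero_fractional_ideal (to_fract ` I)"
    unfolding nonzero_fractional_ideal_def
  proof (intro conjI exI)
    show "to_fract ` I \<noteq> {0}" using b by (metis image_eqI singletonD to_fract_eq_0_iff)
    show "fract_scale 1 ` to_fract ` I \<subseteq> range to_fract" by (auto simp: fract_scale_def)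
  qed (use sub in simp_all)
  moreover have "to_fract ` I \<subseteq> t_closure (to_fract ` I)"
  proof
    fix x assume "x \<in> to_fract ` I"
    then obtain a where a: "a \<in> I" "x = to_fract a" by blast
    let ?J = "module.span fract_scale {to_fract a, to_fract b}"
    have "x \<in> ?J" using a by (auto intro: module.span_base[OF module_fract_scale])
    then have "x \<in> v_closure ?J" by (auto simp: mem_v_closure_iff mult.commute)
    moreover have "?J \<subseteq> to_fract ` I"
      using a b by (intro module.span_minimal[OF module_fract_scale _ sub]) auto
    ultimately show "x \<in> t_closure (to_fract ` I)"
      using fg_nonzero_fractional_ideal_span[OF b(2)] unfolding t_closure_def by blast
  qed
  moreover have "v_closure J \<subseteq> to_fract ` I"
    if J: "J \<subseteq> to_fract ` I" "fg_nonzero_fractional_ideal J" for J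
  proof
    fix x assume x: "x \<in> v_closure J"
    obtain S where S: "finite S" "J = module.span fract_scale S"
      using J(2) by (auto simp: fg_nonzero_fractional_ideal_def)
    have "S \<subseteq> to_fract ` I"
      using J(1) S(2) module.span_superset[OF module_fract_scale] by blast
    with S(1) have "\<exists>d\<in>I. d \<noteq> 0 \<and> S \<subseteq> range (\<lambda>c. to_fract (d * c))"
    proof (induction S)
      case empty
      then show ?case using b by auto
    next
      case (insert s S)
      then obtain d where d: "d \<in> I" "d \<noteq> 0" "S \<subseteq> range (\<lambda>c. to_fract (d * c))" by auto
      obtain a where a: "a \<in> I" "s = to_fract a" using insert.prems by blast
      obtain e where e: "e \<in> I" "e dvd d" "e dvd a"
        using directed_ideal_common_divisor[OF I d(1) a(1)] by blast
      obtain f where f: "d = e * f" using e by blast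
      have "S \<subseteq> range (\<lambda>c. to_fract (e * c))"
      proof
        fix y assume "y \<in> S"
        then obtain c where "y = to_fract (d * c)" using d by blast
        then have "y = to_fract (e * (f * c))" using f by (simp add: mult.assoc)
        then show "y \<in> range (\<lambda>c. to_fract (e * c))" by blast
      qed
      moreover have "s \<in> range (\<lambda>c. to_fract (e * c))" using a e unfolding dvd_def by blast
      moreover have "e \<noteq> 0" using f d by auto
      ultimately show ?case using e by blast
    qed
    then obtain d where d: "d \<in> I" "d \<noteq> 0" "S \<subseteq> range (\<lambda>c. to_fract (d * c))" by blast
    have J_sub: "J \<subseteq> range (\<lambda>c. to_fract (d * c))"
      unfolding S(2) by (rule module.span_minimal[OF module_fract_scale d(3) fract_subspace_multiples])
    have "\<forall>z\<in>J. inverse (to_fract d) * z \<in> range to_fract"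
    proof
      fix z assume "z \<in> J"
      then obtain c where "z = to_fract (d * c)" using J_sub by blast
      then have "inverse (to_fract d) * z = to_fract c" using d(2) by simp
      then show "inverse (to_fract d) * z \<in> range to_fract" by simp
    qed
    then have "x * inverse (to_fract d) \<in> range to_fract" using x unfolding mem_v_closure_iff by blast
    then obtain c where "x * inverse (to_fract d) = to_fract c" by blast
    then have "x = to_fract (d * c)" using d(2) by (simp add: field_simps)
    moreover have "d * c \<in> I" using directed_ideal_dvd[OF I d(1)] by simp
    ultimately show "x \<in> to_fract ` I" by blast
  qed
  then have "t_closure (to_fract ` I) \<subseteq> to_fract ` I" unfolding t_closure_def by blast
  ultimately show ?thesis unfolding t_ideal_def by blast
qed

text \<open>The greatest common divisor \<open>d\<close> of \<open>a\<close> and \<open>b\<close> belongs to \<open>(a, b)\<^sub>v\<close>: if \<open>r / s\<close> multiplies \<open>a\<close>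
  and \<open>b\<close> into the domain, then \<open>s\<close> divides \<open>r * a\<close> and \<open>r * b\<close>, hence their greatest common divisor
  \<open>r * d\<close>.\<close>

lemma t_ideal_imp_directed_ideal:
  assumes G: "GCD_domain TYPE('a::idom)" and t: "t_ideal (to_fract ` (I :: 'a set))"
  shows "directed_ideal I"
proof -
  have sub: "module.subspace fract_scale (to_fract ` I)" and n0: "to_fract ` I \<noteq> {0}"
    using t by (auto simp: t_ideal_def nonzero_fractional_ideal_def)
  have mem: "to_fract x \<in> to_fract ` I \<longleftrightarrow> x \<in> I" for x :: 'a by (auto simp: image_iff)
  have zero: "0 \<in> I" using sub mem[of 0] by (simp add: fract_subspace_iff)
  have nonzero: "\<exists>x\<in>I. x \<noteq> 0" using n0 zero by force
  have dvd: "x \<in> I" if ax: "a \<in> I" "a dvd x" for a x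
  proof -
    obtain c where "x = c * a" using ax(2) by (metis dvdE mult.commute)
    then show ?thesis using sub ax(1) mem[of x] by (auto simp: fract_subspace_iff)
  qed
  have directed: "\<exists>d\<in>I. d dvd a \<and> d dvd b" if ab: "a \<in> I" "b \<in> I" for a b
  proof (cases "b = 0")
    case True
    then show ?thesis using ab(1) by (intro bexI[of _ a]) auto
  next
    case False
    let ?J = "module.span fract_scale {to_fract a, to_fract b}"
    obtain d where d: "is_gcd d a b" using GCD_domain_gcd_exists[OF G] .
    have "to_fract d * y \<in> range to_fract" if y: "\<forall>z\<in>?J. y * z \<in> range to_fract" for y
    proof -
      obtain r s where rs: "y = to_fract r / to_fract s" "s \<noteq> 0"
        by (cases y) (auto simp: Fract_conv_to_fract)
      have *: "s dvd r * c" if c: "to_fract c \<in> ?J" for c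
      proof -
        obtain p where "y * to_fract c = to_fract p" using y c by blast
        then have "to_fract (r * c) = to_fract (s * p)" using rs by (simp add: field_simps)
        then show ?thesis by (simp del: to_fract_mult)
      qed
      have "s dvd r * a" "s dvd r * b"
        by (intro * module.span_base[OF module_fract_scale]; simp)+
      then have "s dvd r * d" using is_gcd_mult_left[OF G d, of r] by (auto simp: is_gcd_def)
      then obtain q where "r * d = s * q" by blast
      then have "to_fract r * to_fract d = to_fract s * to_fract q" by (metis to_fract_mult)
      moreover have "to_fract d * y = (to_fract r * to_fract d) / to_fract s" using rs by simp
      ultimately have "to_fract d * y = to_fract q" using rs(2) by simp
      then show ?thesis by blast
    qed
    then have "to_fract d \<in> v_closure ?J" by (simp add: mem_v_closure_iff)
    moreover have "?J \<subseteq> to_fract ` I"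
      using ab by (intro module.span_minimal[OF module_fract_scale _ sub]) auto
    ultimately have "to_fract d \<in> t_closure (to_fract ` I)"
      using fg_nonzero_fractional_ideal_span[OF False] unfolding t_closure_def by blast
    then have "d \<in> I" using t mem by (simp add: t_ideal_def)
    then show ?thesis using d unfolding is_gcd_def by blast
  qed
  show ?thesis
    unfolding directed_ideal_def
    by (intro conjI ballI allI impI zero nonzero directed; (assumption | erule (1) dvd))
qed

lemma proper_integral_t_ideal_iff:
  assumes "GCD_domain TYPE('a::idom)"
  shows "proper_integral_t_ideal I \<longleftrightarrow> directed_ideal (I :: 'a set) \<and> 1 \<notin> I"
  using directed_ideal_imp_t_ideal t_ideal_imp_directed_ideal[OF assms] directed_ideal_eq_UNIV_iff
  unfolding proper_integral_t_ideal_def by blast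

lemma maximal_t_ideal_iff:
  assumes "GCD_domain TYPE('a::idom)"
  shows "maximal_t_ideal M \<longleftrightarrow> directed_ideal (M :: 'a set) \<and> 1 \<notin> M \<and>
    (\<forall>J. directed_ideal J \<and> 1 \<notin> J \<and> M \<subseteq> J \<longrightarrow> J = M)"
  unfolding maximal_t_ideal_def proper_integral_t_ideal_iff[OF assms] by blast

section \<open>Maximal \<open>t\<close>-ideals of a GCD-domain\<close>

lemma maximal_t_ideal_directed:
  assumes "GCD_domain TYPE('a::idom)" "maximal_t_ideal (M :: 'a set)"
  shows "directed_ideal M"
  using assms(2) unfolding maximal_t_ideal_iff[OF assms(1)] by blast

lemma maximal_t_ideal_one:
  assumes "GCD_domain TYPE('a::idom)" "maximal_t_ideal (M :: 'a set)"
  shows "1 \<notin> M"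
  using assms(2) unfolding maximal_t_ideal_iff[OF assms(1)] by blast

text \<open>If \<open>x * y \<in> M\<close>, then the quotient ideal \<open>(M : y)\<close> is again directed and contains both \<open>M\<close> and
  \<open>x\<close>. So it is \<open>M\<close>, and then \<open>x \<in> M\<close>, or it contains \<open>1\<close>, and then \<open>y \<in> M\<close>.\<close>

lemma maximal_t_ideal_prime:
  assumes G: "GCD_domain TYPE('a::idom)" and M: "maximal_t_ideal (M :: 'a set)" and xy: "x * y \<in> M"
  shows "x \<in> M \<or> y \<in> M"
proof -
  let ?J = "{z. z * y \<in> M}"
  note dM = maximal_t_ideal_directed[OF G M]
  have MJ: "M \<subseteq> ?J" using directed_ideal_dvd[OF dM] by auto
  have "directed_ideal ?J"
    unfolding directed_ideal_def
  proof (intro conjI ballI allI impI)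
    show "0 \<in> ?J" using directed_ideal_zero[OF dM] by simp
    show "\<exists>x\<in>?J. x \<noteq> 0" using directed_ideal_nonzero[OF dM] MJ by (meson subsetD)
  next
    fix a z assume "a \<in> ?J" "a dvd z"
    then show "z \<in> ?J" using directed_ideal_dvd[OF dM, of "a * y" "z * y"] by (simp add: mult_dvd_mono)
  next
    fix a b assume ab: "a \<in> ?J" "b \<in> ?J"
    obtain d where d: "is_gcd d a b" using GCD_domain_gcd_exists[OF G] .
    then have "is_gcd (y * d) (y * a) (y * b)" by (rule is_gcd_mult_left[OF G])
    moreover have "y * a \<in> M" "y * b \<in> M" using ab by (simp_all add: mult.commute)
    ultimately have "y * d \<in> M" using directed_ideal_gcd[OF dM] by blast
    then have "d \<in> ?J" by (simp add: mult.commute)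
    then show "\<exists>d\<in>?J. d dvd a \<and> d dvd b" using d unfolding is_gcd_def by blast
  qed
  then have "1 \<in> ?J \<or> ?J = M" using M MJ unfolding maximal_t_ideal_iff[OF G] by blast
  then show ?thesis using xy by auto
qed

lemma maximal_t_ideal_nonunit:
  assumes "GCD_domain TYPE('a::idom)" "maximal_t_ideal (M :: 'a set)" "x \<in> M"
  shows "\<not> x dvd 1"
  using directed_ideal_dvd[OF maximal_t_ideal_directed[OF assms(1,2)] assms(3)]
    maximal_t_ideal_one[OF assms(1,2)] by blast

lemma maximal_t_ideal_dvd:
  assumes "GCD_domain TYPE('a::idom)" "maximal_t_ideal (M :: 'a set)" "x \<in> M" "x dvd y"
  shows "y \<in> M"
  using directed_ideal_dvd[OF maximal_t_ideal_directed[OF assms(1,2)] assms(3,4)] .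

lemma maximal_t_ideal_not_relatively_prime:
  assumes "GCD_domain TYPE('a::idom)" "maximal_t_ideal (M :: 'a set)" "x \<in> M" "y \<in> M"
  shows "\<not> relatively_prime x y"
  using directed_ideal_common_divisor[OF maximal_t_ideal_directed[OF assms(1,2)] assms(3,4)]
    maximal_t_ideal_nonunit[OF assms(1,2)] unfolding relatively_prime_def by blast

lemma maximal_t_ideal_exists:
  assumes G: "GCD_domain TYPE('a::idom)" and x: "(x::'a) \<noteq> 0" "\<not> x dvd 1"
  shows "\<exists>M. maximal_t_ideal M \<and> x \<in> M"
proof -
  define \<A> where "\<A> = {J. directed_ideal J \<and> 1 \<notin> J \<and> x \<in> J}"
  have "{z. x dvd z} \<in> \<A>"
    unfolding \<A>_def directed_ideal_def using x by simp (meson dvd_refl dvd_trans)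
  then have "\<A> \<noteq> {}" by blast
  then have "\<exists>M\<in>\<A>. \<forall>X\<in>\<A>. M \<subseteq> X \<longrightarrow> X = M"
  proof (rule subset_Zorn_nonempty)
    fix \<C> assume ne: "\<C> \<noteq> {}" and "subset.chain \<A> \<C>"
    then have sub: "\<C> \<subseteq> \<A>" and chain: "\<And>X Y. X \<in> \<C> \<Longrightarrow> Y \<in> \<C> \<Longrightarrow> X \<subseteq> Y \<or> Y \<subseteq> X"
      by (auto simp: subset_chain_def)
    have dC: "directed_ideal X" "1 \<notin> X" "x \<in> X" if "X \<in> \<C>" for X
      using that sub by (auto simp: \<A>_def)
    have "directed_ideal (\<Union>\<C>)"
      unfolding directed_ideal_def
    proof (intro conjI ballI allI impI)
      show "0 \<in> \<Union>\<C>" "\<exists>x\<in>\<Union>\<C>. x \<noteq> 0" using ne dC(1) directed_ideal_zero directed_ideal_nonzero by blast+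
    next
      fix a z assume "a \<in> \<Union>\<C>" "a dvd z"
      then show "z \<in> \<Union>\<C>" using dC directed_ideal_dvd by blast
    next
      fix a b assume "a \<in> \<Union>\<C>" "b \<in> \<Union>\<C>"
      then obtain X where "X \<in> \<C>" "a \<in> X" "b \<in> X" using chain by blast
      then show "\<exists>d\<in>\<Union>\<C>. d dvd a \<and> d dvd b" using directed_ideal_common_divisor dC by blast
    qed
    then show "\<Union>\<C> \<in> \<A>" using ne dC by (auto simp: \<A>_def)
  qed
  then obtain M where M: "M \<in> \<A>" "\<And>X. X \<in> \<A> \<Longrightarrow> M \<subseteq> X \<Longrightarrow> X = M" by blast
  then have "maximal_t_ideal M" unfolding maximal_t_ideal_iff[OF G] \<A>_def by blast
  then show ?thesis using M by (auto simp: \<A>_def)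
qed

text \<open>The elements that are not coprime to a valuation element \<open>a\<close> form an ideal: two nonunits
  that both divide \<open>a\<close> are comparable. Every proper directed ideal that contains \<open>a\<close> lies inside it.\<close>

lemma maximal_t_ideal_of_valuation_element:
  assumes G: "GCD_domain TYPE('a::idom)" and a: "valuation_element (a::'a)"
    and M: "maximal_t_ideal M" "a \<in> M"
  shows "M = {x. \<not> relatively_prime x a}"
proof -
  let ?N = "{x. \<not> relatively_prime x a}"
  have N: "e \<in> ?N" if "e dvd a" "\<not> e dvd 1" for e
    using that dvd_refl[of e] unfolding relatively_prime_def by blast
  have aN: "a \<in> ?N" by (rule N) (use valuation_element_nonunit[OF a] in simp_all)
  have "directed_ideal ?N"
    unfolding directed_ideal_def
  proof (intro conjI ballI allI impI)
    show "0 \<in> ?N" using aN by (simp add: relatively_prime_def)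
    show "\<exists>x\<in>?N. x \<noteq> 0" using aN valuation_element_nonzero[OF a] by blast
  next
    fix y z assume "y \<in> ?N" "y dvd z"
    then show "z \<in> ?N" unfolding relatively_prime_def mem_Collect_eq by (meson dvd_trans)
  next
    fix y z assume "y \<in> ?N" "z \<in> ?N"
    then obtain e f where e: "e dvd y" "e dvd a" "\<not> e dvd 1" and f: "f dvd z" "f dvd a" "\<not> f dvd 1"
      by (auto simp: relatively_prime_def)
    have "e \<in> ?N" "f \<in> ?N" using N e f by blast+
    moreover have "e dvd f \<or> f dvd e"
      using valuation_element_factors_chain[OF a] e f by (auto simp: incomparable_iff)
    ultimately show "\<exists>d\<in>?N. d dvd y \<and> d dvd z" using e f dvd_trans by blast
  qed
  moreover have "1 \<notin> ?N" by (auto simp: relatively_prime_def)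
  moreover have "M \<subseteq> ?N" using maximal_t_ideal_not_relatively_prime[OF G M(1) _ M(2)] by blast
  ultimately show ?thesis using M(1) unfolding maximal_t_ideal_iff[OF G] by blast
qed

section \<open>A UVFD is a weakly Matlis domain\<close>

lemma prime_prod_list:
  assumes "\<And>x y. x * y \<in> P \<Longrightarrow> x \<in> P \<or> y \<in> P" "1 \<notin> P" "prod_list xs \<in> P"
  shows "\<exists>x\<in>set xs. x \<in> P"
  using assms(3) by (induction xs) (use assms(1,2) in auto)

text \<open>A prime ideal that contains a product of valuation elements contains one of them, and that
  one determines every maximal \<open>t\<close>-ideal in which it lies. So every maximal
  \<open>t\<close>-ideal around a given element comes from one of its finitely many valuation factors, and a
  nonzero prime ideal lies in at most one maximal \<open>t\<close>-ideal.\<close>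

lemma UVFD_imp_weakly_Matlis_domain:
  assumes U: "UVFD TYPE('a::idom)"
  shows "weakly_Matlis_domain TYPE('a)"
proof -
  note G = UVFD_imp_GCD_domain[OF U]
  let ?N = "\<lambda>a. {x::'a. \<not> relatively_prime x a}"
  have "finite {M. maximal_t_ideal M \<and> a \<in> M}" if a: "a \<noteq> 0" "\<not> a dvd 1" for a :: 'a
  proof -
    obtain xs where xs: "incomparable_valuations xs" "prod_list xs = a"
      using UVFD_factorization[OF U a] .
    have "{M. maximal_t_ideal M \<and> a \<in> M} \<subseteq> ?N ` set xs"
    proof clarify
      fix M assume M: "maximal_t_ideal M" "a \<in> M"
      have "1 \<notin> M" using maximal_t_ideal_one[OF G M(1)] .
      then obtain x where x: "x \<in> set xs" "x \<in> M"
        using prime_prod_list[of M xs] maximal_t_ideal_prime[OF G M(1)] M(2) xs(2) by blast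
      then have "valuation_element x" using xs by (auto simp: incomparable_valuations_def)
      then show "M \<in> ?N ` set xs"
        using maximal_t_ideal_of_valuation_element[OF G _ M(1)] x by blast
    qed
    then show ?thesis by (rule finite_subset) simp
  qed
  moreover have "M = N"
    if M: "maximal_t_ideal M" and N: "maximal_t_ideal N"
      and P: "prime_ideal P" "P \<noteq> {0}" "P \<subseteq> M" "P \<subseteq> N" for M N P :: "'a set"
  proof -
    have "0 \<in> P" using P(1) by (simp add: prime_ideal_def module.subspace_def[OF module_times])
    then obtain a where a: "a \<in> P" "a \<noteq> 0" using P(2) by blast
    have nonunit: "\<not> x dvd 1" if "x \<in> P" for x
      using maximal_t_ideal_nonunit[OF G M] P(3) that by blast
    obtain xs where xs: "incomparable_valuations xs" "prod_list xs = a"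
      using UVFD_factorization[OF U a(2)] nonunit a(1) by blast
    have "\<exists>x\<in>set xs. x \<in> P"
    proof (rule prime_prod_list)
      show "1 \<notin> P" using maximal_t_ideal_one[OF G M] P(3) by blast
    qed (use P(1) a xs in \<open>auto simp: prime_ideal_def\<close>)
    then obtain x where x: "x \<in> set xs" "x \<in> P" by blast
    then have "valuation_element x" using xs by (auto simp: incomparable_valuations_def)
    then show ?thesis
      using maximal_t_ideal_of_valuation_element[OF G] M N x P by blast
  qed
  ultimately show ?thesis unfolding weakly_Matlis_domain_def by blast
qed

section \<open>Factorization in weakly Matlis GCD-domains\<close>

definition localization :: "'a::idom set \<Rightarrow> 'a fract set" where
  "localization M = {to_fract p / to_fract q | p q. q \<notin> M}"

lemma localization_valuation_overring:
  assumes G: "GCD_domain TYPE('a::idom)" and M: "maximal_t_ideal (M :: 'a set)"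
  shows "valuation_overring (localization M)"
proof -
  have one: "1 \<notin> M" using maximal_t_ideal_one[OF G M] .
  have zero: "0 \<in> M" using directed_ideal_zero[OF maximal_t_ideal_directed[OF G M]] .
  have mult: "p * q \<notin> M" if "p \<notin> M" "q \<notin> M" for p q
    using maximal_t_ideal_prime[OF G M] that by blast
  have locI: "to_fract p / to_fract q \<in> localization M" if "q \<notin> M" for p q
    using that unfolding localization_def by blast
  have "to_fract p \<in> localization M" for p
    using locI[OF one, of p] by simp
  moreover have "x - y \<in> localization M \<and> x * y \<in> localization M"
    if "x \<in> localization M" "y \<in> localization M" for x y
  proof -
    obtain p q r s where pq: "x = to_fract p / to_fract q" "q \<notin> M"
      and rs: "y = to_fract r / to_fract s" "s \<notin> M"
      using \<open>x \<in> localization M\<close> \<open>y \<in> localization M\<close> by (auto simp: localization_def)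
    then have "q \<noteq> 0" "s \<noteq> 0" using zero by auto
    then have "x - y = to_fract (p * s - r * q) / to_fract (q * s)"
      "x * y = to_fract (p * r) / to_fract (q * s)"
      using pq rs by (simp_all add: diff_frac_eq)
    then show ?thesis using locI[OF mult[OF pq(2) rs(2)]] by metis
  qed
  moreover have "x \<in> localization M \<or> inverse x \<in> localization M" for x
  proof -
    obtain p q where pq: "x = to_fract p / to_fract q" "q \<noteq> 0"
      by (cases x) (auto simp: Fract_conv_to_fract)
    obtain d p' q' where d: "p = d * p'" "q = d * q'" "relatively_prime p' q'"
      using gcd_cofactors[OF G] .
    have x: "x = to_fract p' / to_fract q'" using d pq by simp
    have "p' \<notin> M \<or> q' \<notin> M" using maximal_t_ideal_not_relatively_prime[OF G M] d(3) by blast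
    then show ?thesis using x locI by (metis inverse_divide)
  qed
  ultimately show ?thesis unfolding valuation_overring_def overring_def by blast
qed

text \<open>The valuation overring is the localization at \<open>M\<close>: an element \<open>q\<close> outside \<open>M\<close> is coprime to
  \<open>a\<close>, since a nonunit common divisor would lie in some maximal \<open>t\<close>-ideal, which must be \<open>M\<close>. So
  \<open>a\<close> cannot be cancelled against denominators.\<close>

lemma valuation_element_if_unique_maximal_t_ideal:
  assumes G: "GCD_domain TYPE('a::idom)" and a: "(a::'a) \<noteq> 0" "\<not> a dvd 1"
    and M: "maximal_t_ideal M" and unique: "\<And>N. maximal_t_ideal N \<Longrightarrow> a \<in> N \<Longrightarrow> N = M"
  shows "valuation_element a"
proof -
  have "a dvd x" if x: "to_fract x / to_fract a \<in> localization M" for x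
  proof -
    obtain p q where pq: "to_fract x / to_fract a = to_fract p / to_fract q" "q \<notin> M"
      using x by (auto simp: localization_def)
    then have "q \<noteq> 0" using directed_ideal_zero[OF maximal_t_ideal_directed[OF G M]] by auto
    then have "to_fract (q * x) = to_fract (a * p)" using pq a by (simp add: field_simps)
    then have "a dvd q * x" by (simp del: to_fract_mult)
    moreover have "relatively_prime a q"
      unfolding relatively_prime_def
    proof (intro allI impI)
      fix c assume c: "c dvd a \<and> c dvd q"
      show "c dvd 1"
      proof (rule ccontr)
        assume "\<not> c dvd 1"
        moreover have "c \<noteq> 0" using c a by auto
        ultimately obtain N where N: "maximal_t_ideal N" "c \<in> N"
          using maximal_t_ideal_exists[OF G] by blast
        then have "N = M" using unique maximal_t_ideal_dvd[OF G N] c by blast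
        then show False using maximal_t_ideal_dvd[OF G N] c pq(2) by blast
      qed
    qed
    ultimately show ?thesis using relatively_prime_dvd_mult[OF G] by blast
  qed
  then show ?thesis
    unfolding valuation_element_iff using a localization_valuation_overring[OF G M] by blast
qed

text \<open>The following \<open>P\<close> is the radical of \<open>x\<close> in the ring of fractions with respect to all products
  \<open>s * t\<close> with \<open>s \<notin> M\<close> and \<open>t \<notin> N\<close>, intersected with the domain. That ring lies above the valuation
  ring at \<open>M\<close>, so \<open>P\<close> is prime, and it is contained in \<open>M\<close> and \<open>N\<close> unless \<open>x\<close> becomes a unit.
  Concretely, with \<open>z = g * z'\<close> and \<open>w = g * w'\<close>, where \<open>z'\<close> and \<open>w'\<close> are coprime, one of \<open>z'\<close> and \<open>w'\<close>
  is outside \<open>M\<close> and can be absorbed into \<open>s\<close>.\<close>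

lemma weakly_Matlis_dvd_mult:
  assumes G: "GCD_domain TYPE('a::idom)" and W: "weakly_Matlis_domain TYPE('a)"
    and M: "maximal_t_ideal (M :: 'a set)" and N: "maximal_t_ideal N" and MN: "M \<noteq> N"
    and x: "x \<noteq> 0"
  shows "\<exists>s t. s \<notin> M \<and> t \<notin> N \<and> x dvd s * t"
proof (rule ccontr)
  assume none: "\<not> ?thesis"
  define P where "P = {z. \<exists>n s t. s \<notin> M \<and> t \<notin> N \<and> x dvd z ^ n * (s * t)}"
  have one: "1 \<notin> M" "1 \<notin> N" using maximal_t_ideal_one[OF G] M N by auto
  have mult: "p * q \<notin> M" if "p \<notin> M" "q \<notin> M" for p q
    using maximal_t_ideal_prime[OF G M] that by blast
  have multN: "p * q \<notin> N" if "p \<notin> N" "q \<notin> N" for p q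
    using maximal_t_ideal_prime[OF G N] that by blast
  have power: "p ^ n \<notin> M" if "p \<notin> M" for p n
    by (induction n) (use one mult that in auto)
  have powerN: "p ^ n \<notin> N" if "p \<notin> N" for p n
    by (induction n) (use one multN that in auto)
  have PI: "z \<in> P" if "s \<notin> M" "t \<notin> N" "x dvd z ^ n * (s * t)" for z n s t
    using that unfolding P_def by blast
  have P_dvd: "z \<in> P" if wz: "w \<in> P" "w dvd z" for w z
  proof -
    obtain n s t where st: "s \<notin> M" "t \<notin> N" "x dvd w ^ n * (s * t)"
      using wz(1) unfolding P_def by blast
    have "w ^ n * (s * t) dvd z ^ n * (s * t)" using wz(2) by (intro mult_dvd_mono dvd_power_same) auto
    then show ?thesis using PI st dvd_trans by blast
  qed
  have absorb: "g \<in> P" if gw: "g * w \<in> P" "w \<notin> M" for g w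
  proof -
    obtain n s t where st: "s \<notin> M" "t \<notin> N" "x dvd (g * w) ^ n * (s * t)"
      using gw(1) unfolding P_def by blast
    then have "x dvd g ^ n * (w ^ n * s * t)" by (simp add: power_mult_distrib mult_ac)
    moreover have "w ^ n * s \<notin> M" using mult power gw(2) st(1) by blast
    ultimately show ?thesis using PI[OF _ st(2), of "w ^ n * s" g n] by blast
  qed
  have sqrt: "z \<in> P" if zz: "z * z \<in> P" for z
  proof -
    obtain n s t where "s \<notin> M" "t \<notin> N" "x dvd (z * z) ^ n * (s * t)"
      using zz unfolding P_def by blast
    then show ?thesis using PI[of s t z "n + n"] by (simp add: power_mult_distrib power_add)
  qed
  have cofactors: "\<exists>g z' w'. z = g * z' \<and> w = g * w' \<and> (z' \<notin> M \<or> w' \<notin> M)" for z w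
    using gcd_cofactors[OF G, of z w] maximal_t_ideal_not_relatively_prime[OF G M] by metis
  have add: "z + w \<in> P" if zw: "z \<in> P" "w \<in> P" for z w
  proof -
    obtain g z' w' where g: "z = g * z'" "w = g * w'" "z' \<notin> M \<or> w' \<notin> M" using cofactors by blast
    then have "g \<in> P" using absorb zw by blast
    then show ?thesis using P_dvd g by auto
  qed
  have prime: "z \<in> P \<or> w \<in> P" if zw: "z * w \<in> P" for z w
  proof -
    obtain g z' w' where g: "z = g * z'" "w = g * w'" "z' \<notin> M \<or> w' \<notin> M" using cofactors by blast
    have "(g * g * z') * w' \<in> P" "(g * g * w') * z' \<in> P" using zw g by (simp_all add: mult_ac)
    then have "g * g * z' \<in> P \<or> g * g * w' \<in> P" using absorb g(3) by blast
    then have "z * z \<in> P \<or> w * w \<in> P"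
      using P_dvd[of "g * g * z'" "z * z"] P_dvd[of "g * g * w'" "w * w"] g(1,2)
      by (auto simp: mult_ac)
    then show ?thesis using sqrt by blast
  qed
  have x_dvd: "x \<in> P" using PI[OF one, of x 1] by simp
  have PM: "P \<subseteq> M"
  proof
    fix z assume "z \<in> P"
    then obtain n s t where st: "s \<notin> M" "t \<notin> N" "x dvd z ^ n * (s * t)"
      unfolding P_def by blast
    then have "x dvd (z ^ n * s) * t" by (simp add: mult.assoc)
    moreover have "z ^ n * s \<notin> M" if "z \<notin> M" using mult[OF power[OF that] st(1)] .
    ultimately show "z \<in> M" using none st(2) by blast
  qed
  have PN: "P \<subseteq> N"
  proof
    fix z assume "z \<in> P"
    then obtain n s t where st: "s \<notin> M" "t \<notin> N" "x dvd z ^ n * (s * t)"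
      unfolding P_def by blast
    then have "x dvd s * (z ^ n * t)" by (simp add: mult_ac)
    moreover have "z ^ n * t \<notin> N" if "z \<notin> N" using multN[OF powerN[OF that] st(2)] .
    ultimately show "z \<in> N" using none st(1) by blast
  qed
  have "module.subspace (*) P"
    unfolding module.subspace_def[OF module_times] using add P_dvd x_dvd by (meson dvd_0_right dvd_triv_right)
  then have "prime_ideal P" unfolding prime_ideal_def using prime PM one by blast
  moreover have "P \<noteq> {0}" using x_dvd x by blast
  ultimately show False using W M N MN PM PN unfolding weakly_Matlis_domain_def by blast
qed

text \<open>As long as \<open>x\<close> lies in two maximal \<open>t\<close>-ideals \<open>M\<close> and \<open>N\<close>, it splits into a factor outside \<open>M\<close>
  and a factor outside \<open>N\<close>, each of which lies in fewer maximal \<open>t\<close>-ideals.\<close>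

lemma weakly_Matlis_valuation_factorization:
  assumes G: "GCD_domain TYPE('a::idom)" and W: "weakly_Matlis_domain TYPE('a)"
    and "(x::'a) \<noteq> 0" "\<not> x dvd 1"
  shows "\<exists>xs. (\<forall>z\<in>set xs. valuation_element z) \<and> prod_list xs = x"
  using assms(3,4)
proof (induction "card {M. maximal_t_ideal M \<and> x \<in> M}" arbitrary: x rule: less_induct)
  case less
  define S where "S y = {M. maximal_t_ideal M \<and> y \<in> M}" for y :: 'a
  have fin: "finite (S x)" using W less.prems unfolding weakly_Matlis_domain_def S_def by blast
  obtain M where M: "maximal_t_ideal M" "x \<in> M"
    using maximal_t_ideal_exists[OF G less.prems] by blast
  show ?case
  proof (cases "\<exists>N. maximal_t_ideal N \<and> x \<in> N \<and> N \<noteq> M")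
    case False
    then have "valuation_element x"
      using valuation_element_if_unique_maximal_t_ideal[OF G less.prems M(1)] by blast
    then show ?thesis by (intro exI[of _ "[x]"]) simp
  next
    case True
    then obtain N where N: "maximal_t_ideal N" "x \<in> N" "M \<noteq> N" by blast
    obtain s t where st: "s \<notin> M" "t \<notin> N" "x dvd s * t"
      using weakly_Matlis_dvd_mult[OF G W M(1) N(1,3) less.prems(1)] by blast
    obtain u v where uv: "x = u * v" "u dvd s" "v dvd t"
      using GCD_domain_split[OF G st(3) less.prems(1)] .
    have uM: "u \<notin> M" using maximal_t_ideal_dvd[OF G M(1)] st uv by blast
    have vN: "v \<notin> N" using maximal_t_ideal_dvd[OF G N(1)] st uv by blast
    have sub: "S u \<subseteq> S x" "S v \<subseteq> S x"
      using maximal_t_ideal_dvd[OF G] uv(1) unfolding S_def by (metis (no_types, lifting) Collect_mono dvd_triv_left dvd_triv_right)+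
    have "M \<in> S x - S u" "N \<in> S x - S v" using M N uM vN by (auto simp: S_def)
    then have card: "card (S u) < card (S x)" "card (S v) < card (S x)"
      using sub fin by (metis DiffD1 DiffD2 psubsetI psubset_card_mono)+
    have "\<not> u dvd 1"
    proof
      assume "u dvd 1"
      then have "x dvd v" using mult_dvd_mono[of u 1 v v] uv(1) by simp
      then show False using maximal_t_ideal_dvd[OF G N(1,2)] vN by blast
    qed
    moreover have "\<not> v dvd 1"
    proof
      assume "v dvd 1"
      then have "x dvd u" using mult_dvd_mono[of u u v 1] uv(1) by simp
      then show False using maximal_t_ideal_dvd[OF G M] uM by blast
    qed
    moreover have "u \<noteq> 0" "v \<noteq> 0" using less.prems uv by auto
    ultimately obtain us vs where
      "\<forall>z\<in>set us. valuation_element z" "prod_list us = u"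
      "\<forall>z\<in>set vs. valuation_element z" "prod_list vs = v"
      using less.hyps[of u] less.hyps[of v] card unfolding S_def by blast
    then show ?thesis using uv(1) by (intro exI[of _ "us @ vs"]) auto
  qed
qed

lemma weakly_Matlis_GCD_domain_imp_UVFD:
  assumes G: "GCD_domain TYPE('a::idom)" and W: "weakly_Matlis_domain TYPE('a)"
  shows "UVFD TYPE('a)"
  unfolding UVFD_def
proof (rule conjI; intro allI impI; elim conjE)
  fix a :: 'a assume a: "a \<noteq> 0" "\<not> a dvd 1"
  obtain xs where xs: "incomparable_valuations xs" "prod_list xs = a"
    using weakly_Matlis_valuation_factorization[OF G W a] valuation_product_imp_incomparable by metis
  then have "xs \<noteq> []" using a by auto
  then show "\<exists>xs. incomparable_valuation_seq xs \<and> a = prod_list xs"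
    using xs unfolding incomparable_valuation_seq_iff by blast
qed (rule GCD_domain_factorization_unique[OF G])

theorem corollary4p5:
  shows "UVFD TYPE('a::idom) \<longleftrightarrow> weakly_Matlis_GCD_domain TYPE('a)"
  using UVFD_imp_GCD_domain UVFD_imp_weakly_Matlis_domain weakly_Matlis_GCD_domain_imp_UVFD
  unfolding weakly_Matlis_GCD_domain_def by blast

end
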